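(* Let $N\ge1$ be an integer and $h=\frac1N$. The optimal coefficients of the quadrature formulas of the form $\int_0^1\varphi(x)\,dx\cong\sum_{\beta=0}^NC_\beta\varphi(h\beta)$ in the space $W_2^{(1,0)}(0,1)$ are $$ C_\beta=\begin{cases}\dfrac{e^h-1}{e^h+1},&\beta=0,N,\\[2mm]\dfrac{2(e^h-1)}{e^h+1},&\beta=1,\dots,N-1.\end{cases} $$
   Context: $W_2^{(1,0)}(0,1)$ is the space of absolutely continuous functions $\varphi$ on $[0,1]$ with $\varphi'\in L_2(0,1)$, with (semi)norm $\|\varphi\|=\left\{\int_0^1(\varphi'(x)+\varphi(x))^2dx\right\}^{1/2}$ (functions differing by a multiple of $e^{-x}$, the kernel, are identified). The error functional is $(\ell_N,\varphi)=\int_0^1\varphi(x)dx-\sum_{\beta=0}^NC_\beta\varphi(h\beta)$, with norm $\|\ell_N\|=\sup_{\|\varphi\|=1}|(\ell_N,\varphi)|$ (finite only if the formula is exact for $e^{-x}$). The optimal coefficients are the values $C_0,\dots,C_N$ at which $\inf_{C_\beta}\|\ell_N\|$ over all real coefficients, with the nodes $h\beta$ fixed, is attained. *)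

theory Defs
  imports "HOL-Analysis.Analysis"
begin

text \<open>
  Absolute continuity on \<open>[l, u]\<close> in the usual \<open>\<epsilon>\<close>-\<open>\<delta>\<close> sense, for finite
  families of non-overlapping subintervals. (The constant \<^const>\<open>absolutely_continuous\<close>
  concerns measures.)
\<close>
definition abs_continuous_on_interval :: "real \<Rightarrow> real \<Rightarrow> (real \<Rightarrow> real) \<Rightarrow> bool" where
  "abs_continuous_on_interval l u f \<longleftrightarrow>
    (\<forall>\<epsilon>>0. \<exists>\<delta>>0. \<forall>(n::nat) (a :: nat \<Rightarrow> real) (b :: nat \<Rightarrow> real).
      (\<forall>i<n. l \<le> a i \<and> a i \<le> b i \<and> b i \<le> u) \<longrightarrow>
      (\<forall>i<n. \<forall>j<n. i \<noteq> j \<longrightarrow> {a i<..<b i} \<inter> {a j<..<b j} = {}) \<longrightarrow>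
      (\<Sum>i<n. b i - a i) < \<delta> \<longrightarrow>
      (\<Sum>i<n. \<bar>f (b i) - f (a i)\<bar>) < \<epsilon>)"

definition square_integrable_01 :: "(real \<Rightarrow> real) \<Rightarrow> bool" where
  "square_integrable_01 g \<longleftrightarrow>
    g \<in> borel_measurable (lebesgue_on {0..1}) \<and> integrable (lebesgue_on {0..1}) (\<lambda>x. (g x)\<^sup>2)"

text \<open>
  The space \<open>W\<^sub>2\<^sup>(\<^sup>1\<^sup>,\<^sup>0\<^sup>)(0,1)\<close>. By Lebesgue's theorem the condition on a.e. differentiability
  follows from absolute continuity; it is stated because \<^const>\<open>deriv\<close> is unspecified at
  points of non-differentiability. Elements are functions rather than classes modulo
  multiples of \<open>exp (-x)\<close>.
\<close>
definition W2_10 :: "(real \<Rightarrow> real) set" where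
  "W2_10 = {\<phi>. abs_continuous_on_interval 0 1 \<phi> \<and>
                (AE x in lebesgue_on {0..1}. \<phi> field_differentiable (at x)) \<and>
                square_integrable_01 (deriv \<phi>)}"

definition W2_10_norm :: "(real \<Rightarrow> real) \<Rightarrow> real" where
  "W2_10_norm \<phi> = sqrt (LINT x|lebesgue_on {0..1}. (deriv \<phi> x + \<phi> x)\<^sup>2)"

definition error_functional :: "nat \<Rightarrow> (nat \<Rightarrow> real) \<Rightarrow> (real \<Rightarrow> real) \<Rightarrow> real" where
  "error_functional N C \<phi> =
    (LINT x|lebesgue_on {0..1}. \<phi> x) - (\<Sum>\<beta>=0..N. C \<beta> * \<phi> ((1 / real N) * real \<beta>))"

text \<open>
  The value is \<open>\<infinity>\<close> when the formula is not exact for \<open>exp (-x)\<close>, since then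
  adding multiples of \<open>exp (-x)\<close> changes the error but not the seminorm.
\<close>
definition error_norm :: "nat \<Rightarrow> (nat \<Rightarrow> real) \<Rightarrow> ereal" where
  "error_norm N C =
    (SUP \<phi>\<in>{\<phi> \<in> W2_10. W2_10_norm \<phi> = 1}. ereal \<bar>error_functional N C \<phi>\<bar>)"

text \<open>Only the values \<open>C 0, \<dots>, C N\<close> of a coefficient family matter.\<close>
definition optimal_coefficients :: "nat \<Rightarrow> (nat \<Rightarrow> real) \<Rightarrow> bool" where
  "optimal_coefficients N C \<longleftrightarrow> error_norm N C = (INF D. error_norm N D)"

end

theory Submission
  imports Defs
begin

text \<open>
  Let \<open>K\<close> be, on each mesh cell, the function \<open>1 - a exp\<close> with the coefficient \<open>a\<close> that makes it
  orthogonal to \<open>exp\<close>. It takes the values \<open>tanh (h/2)\<close> and \<open>-tanh (h/2)\<close> at the left and right end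
  of the cell, and \<open>K \<phi>' + K \<phi> = (K \<phi>)' + \<phi>\<close> inside it. Integrating over the cells shows that the
  error functional with the claimed coefficients is \<open>\<phi> \<mapsto> \<integral> K (\<phi>' + \<phi>)\<close>, so its norm is at most
  the \<open>L\<^sub>2\<close> norm of \<open>K\<close>. By orthogonality \<open>K = \<phi>\<^sub>0' + \<phi>\<^sub>0\<close> for a function \<open>\<phi>\<^sub>0\<close> that vanishes at
  all nodes. The error at \<open>\<phi>\<^sub>0\<close> is therefore the same for all coefficients, namely \<open>\<integral> \<phi>\<^sub>0 = \<integral> K\<^sup>2\<close>,
  and the norm of \<open>K\<close> is a lower bound for all error norms. If it is attained, then \<open>\<phi>\<^sub>0\<close> maximises
  the quotient of error and norm; the first variation at \<open>\<phi>\<^sub>0\<close> determines the error functional on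
  polynomials, and hence, by interpolation, the coefficients.
\<close>

section \<open>Absolutely continuous functions\<close>

text \<open>Enumerating a finite index set reduces an arbitrary finite family to the initial
  segments of the naturals used in the definition. The freedom of index type is what allows tagged
  intervals themselves, or a single unit value, to serve as indices.\<close>

lemma abs_continuous_family:
  assumes "abs_continuous_on_interval l u f" "\<epsilon> > 0"
  obtains \<delta> where "\<delta> > 0"
    "\<forall>(I::'i set) a b. finite I \<longrightarrow> (\<forall>i\<in>I. l \<le> a i \<and> a i \<le> b i \<and> b i \<le> u) \<longrightarrow>
      (\<forall>i\<in>I. \<forall>j\<in>I. i \<noteq> j \<longrightarrow> {a i<..<b i} \<inter> {a j<..<b j} = {}) \<longrightarrow>
      (\<Sum>i\<in>I. b i - a i) < \<delta> \<longrightarrow> (\<Sum>i\<in>I. \<bar>f (b i) - f (a i)\<bar>) < \<epsilon>"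
proof -
  obtain \<delta> where "\<delta> > 0" and \<delta>: "\<forall>(n::nat) (a :: nat \<Rightarrow> real) (b :: nat \<Rightarrow> real).
      (\<forall>i<n. l \<le> a i \<and> a i \<le> b i \<and> b i \<le> u) \<longrightarrow>
      (\<forall>i<n. \<forall>j<n. i \<noteq> j \<longrightarrow> {a i<..<b i} \<inter> {a j<..<b j} = {}) \<longrightarrow>
      (\<Sum>i<n. b i - a i) < \<delta> \<longrightarrow> (\<Sum>i<n. \<bar>f (b i) - f (a i)\<bar>) < \<epsilon>"
    using assms(1)[unfolded abs_continuous_on_interval_def, THEN spec, THEN mp, OF assms(2)]
    by (elim exE conjE) (rule that)
  have "(\<Sum>i\<in>I. \<bar>f (b i) - f (a i)\<bar>) < \<epsilon>"
    if "finite I" and ab: "\<And>i. i \<in> I \<Longrightarrow> l \<le> a i \<and> a i \<le> b i \<and> b i \<le> u"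
      and dj: "\<And>i j. i \<in> I \<Longrightarrow> j \<in> I \<Longrightarrow> i \<noteq> j \<Longrightarrow> {a i<..<b i} \<inter> {a j<..<b j} = {}"
      and less: "(\<Sum>i\<in>I. b i - a i) < \<delta>" for I :: "'i set" and a b
  proof -
    obtain g where g: "bij_betw g {..<card I} I"
      using ex_bij_betw_nat_finite[OF \<open>finite I\<close>] by (auto simp: atLeast0LessThan)
    have gI: "g i \<in> I" if "i < card I" for i
      using g that by (auto simp: bij_betw_def)
    have inj: "g i \<noteq> g j" if "i < card I" "j < card I" "i \<noteq> j" for i j
      using g that by (auto simp: bij_betw_def inj_on_def)
    have "(\<Sum>i<card I. \<bar>f (b (g i)) - f (a (g i))\<bar>) < \<epsilon>"
    proof (rule \<delta>[rule_format])
      show "(\<Sum>i<card I. b (g i) - a (g i)) < \<delta>"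
        using sum.reindex_bij_betw[OF g, of "\<lambda>i. b i - a i"] less by simp
    qed (use ab dj gI inj in auto)
    then show ?thesis
      using sum.reindex_bij_betw[OF g, of "\<lambda>i. \<bar>f (b i) - f (a i)\<bar>"] by simp
  qed
  with \<open>\<delta> > 0\<close> show ?thesis by (intro that) auto
qed

text \<open>Open intervals that are pairwise disjoint have total length equal to the measure of
  their union. This turns a small open cover of an exceptional set into the length bound that
  absolute continuity asks for.\<close>

lemma sum_length_disjoint_le_measure:
  fixes a b :: "'i \<Rightarrow> real"
  assumes "finite I" "\<And>i. i \<in> I \<Longrightarrow> a i \<le> b i"
    and "\<And>i j. i \<in> I \<Longrightarrow> j \<in> I \<Longrightarrow> i \<noteq> j \<Longrightarrow> {a i<..<b i} \<inter> {a j<..<b j} = {}"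
    and "\<And>i. i \<in> I \<Longrightarrow> {a i<..<b i} \<subseteq> U" "U \<in> lmeasurable"
  shows "(\<Sum>i\<in>I. b i - a i) \<le> measure lebesgue U"
proof -
  have "(\<Sum>i\<in>I. b i - a i) = (\<Sum>i\<in>I. measure lebesgue {a i<..<b i})"
    using assms(2) by (intro sum.cong) (auto simp: measure_completion)
  also have "\<dots> = measure lebesgue (\<Union>i\<in>I. {a i<..<b i})"
    using assms(1-3)
    by (intro measure_finite_Union[symmetric]) (auto simp: disjoint_family_on_def)
  also have "\<dots> \<le> measure lebesgue U"
    using assms(1,4,5) by (intro measure_mono_fmeasurable UN_least) auto
  finally show ?thesis .
qed

text \<open>
  Intervals tagged in the exceptional null set have small total length, so absolute
  continuity controls them; the others are handled by differentiability at the tag.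
\<close>
theorem fundamental_theorem_of_calculus_abs_continuous:
  fixes F f :: "real \<Rightarrow> real"
  assumes ac: "abs_continuous_on_interval a b F" and "a < b" and "negligible E"
    and der: "\<And>x. x \<in> {a..b} - E \<Longrightarrow> (F has_vector_derivative f x) (at x within {a..b})"
  shows "(f has_integral (F b - F a)) {a..b}"
proof -
  \<comment> \<open>On \<open>E\<close> nothing is known about \<open>f\<close>. With the value 0
    there, the error term of an interval tagged in \<open>E\<close> is just the increment of
    \<open>F\<close>; changing the integrand on a negligible set is undone at the end.\<close>
  define f' where "f' x = (if x \<in> E then 0 else f x)" for x
  have "(f' has_integral (F b - F a)) {a..b}"
    unfolding has_integral_factor_content box_real[symmetric]
  proof safe
    fix e :: real
    assume "e > 0"
    \<comment> \<open>Half of the admissible error \<open>e * (b - a)\<close>: one half is spent on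
      tags in \<open>E\<close>, the other on the remaining tags.\<close>
    define e' where "e' = e / 2 * (b - a)"
    have "e' > 0" using \<open>e > 0\<close> \<open>a < b\<close> by (simp add: e'_def)
    obtain \<delta> where "\<delta> > 0" and \<delta>: "\<forall>(I::(real \<times> real set) set) l u. finite I \<longrightarrow>
        (\<forall>i\<in>I. a \<le> l i \<and> l i \<le> u i \<and> u i \<le> b) \<longrightarrow>
        (\<forall>i\<in>I. \<forall>j\<in>I. i \<noteq> j \<longrightarrow> {l i<..<u i} \<inter> {l j<..<u j} = {}) \<longrightarrow>
        (\<Sum>i\<in>I. u i - l i) < \<delta> \<longrightarrow> (\<Sum>i\<in>I. \<bar>F (u i) - F (l i)\<bar>) < e'"
      by (rule abs_continuous_family[OF ac \<open>e' > 0\<close>])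
    have E: "E \<in> lmeasurable" "measure lebesgue E = 0"
      using \<open>negligible E\<close> by (auto simp: negligible_imp_measurable negligible_imp_measure0)
    obtain U where "open U" "E \<subseteq> U" "U - E \<in> lmeasurable" "emeasure lebesgue (U - E) < ennreal \<delta>"
      using sets_lebesgue_outer_open[OF fmeasurableD[OF E(1)] \<open>\<delta> > 0\<close>] by metis
    moreover have "U = (U - E) \<union> E" using \<open>E \<subseteq> U\<close> by auto
    ultimately have U: "U \<in> lmeasurable"
      by (metis E(1) fmeasurable.Un)
    have "measure lebesgue (U - E) < \<delta>"
      using \<open>emeasure lebesgue (U - E) < ennreal \<delta>\<close> \<open>U - E \<in> lmeasurable\<close> \<open>\<delta> > 0\<close>
      by (metis emeasure_eq_measure2 ennreal_less_iff measure_nonneg)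
    then have mU: "measure lebesgue U < \<delta>"
      using measure_Diff_null_set[of U lebesgue E] \<open>negligible E\<close> U
      by (simp add: negligible_iff_null_sets fmeasurableD)
    \<comment> \<open>The radius of the gauge at \<open>x\<close>: outside \<open>E\<close> it comes
      from differentiability with tolerance \<open>e/2\<close>, inside \<open>E\<close> it keeps the
      ball within the open set \<open>U\<close> of measure less than
      \<open>\<delta>\<close>.\<close>
    have "\<forall>x. \<exists>d>0. (x \<in> {a..b} - E \<longrightarrow>
         (\<forall>y\<in>{a..b}. norm (y-x) < d \<longrightarrow> norm (F y - F x - (y-x) *\<^sub>R f x) \<le> e/2 * norm (y-x)))
         \<and> (x \<in> E \<longrightarrow> ball x d \<subseteq> U)"
    proof
      fix x
      show "\<exists>d>0. (x \<in> {a..b} - E \<longrightarrow>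
         (\<forall>y\<in>{a..b}. norm (y-x) < d \<longrightarrow> norm (F y - F x - (y-x) *\<^sub>R f x) \<le> e/2 * norm (y-x)))
         \<and> (x \<in> E \<longrightarrow> ball x d \<subseteq> U)"
      proof (cases "x \<in> E")
        case True
        then show ?thesis using \<open>open U\<close> \<open>E \<subseteq> U\<close> open_contains_ball by blast
      next
        case False
        show ?thesis
        proof (cases "x \<in> {a..b}")
          case True
          then show ?thesis
            using der[of x] False half_gt_zero[OF \<open>e > 0\<close>]
            unfolding has_vector_derivative_def has_derivative_within_alt by blast
        qed (use False zero_less_one in blast)
      qed
    qed
    then obtain d where d: "\<And>x. 0 < d x"
      and der': "\<And>x y. \<lbrakk>x \<in> {a..b} - E; y \<in> {a..b}; norm (y-x) < d x\<rbrakk>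
                    \<Longrightarrow> norm (F y - F x - (y-x) *\<^sub>R f x) \<le> e/2 * norm (y-x)"
      and dU: "\<And>x. x \<in> E \<Longrightarrow> ball x (d x) \<subseteq> U"
      by metis
    show "\<exists>d. gauge d \<and> (\<forall>p. p tagged_division_of (cbox a b) \<and> d fine p \<longrightarrow>
      norm ((\<Sum>(x, k)\<in>p. measure lborel k *\<^sub>R f' x) - (F b - F a)) \<le> e * measure lborel (cbox a b))"
    proof (rule exI, safe)
      show "gauge (\<lambda>x. ball x (d x))"
        using d gauge_ball_dependent by blast
    next
      fix p
      assume ptag: "p tagged_division_of cbox a b" and finep: "(\<lambda>x. ball x (d x)) fine p"
      have "finite p" using ptag by blast
      have ba: "b - a = (\<Sum>(x,K)\<in>p. Sup K - Inf K)" "F b - F a = (\<Sum>(x,K)\<in>p. F (Sup K) - F (Inf K))"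
        using additive_tagged_division_1[OF less_imp_le[OF \<open>a < b\<close>], of p "\<lambda>x. x"]
          additive_tagged_division_1[OF less_imp_le[OF \<open>a < b\<close>], of p F] ptag by simp_all
      have K: "K = {Inf K..Sup K} \<and> Inf K \<le> x \<and> x \<le> Sup K \<and> a \<le> Inf K \<and> Sup K \<le> b \<and> K \<subseteq> ball x (d x)"
        if "(x, K) \<in> p" for x K
      proof -
        obtain u v where uv: "K = cbox u v" using tagged_division_ofD(4)[OF ptag \<open>(x, K) \<in> p\<close>] by blast
        have "x \<in> K" "K \<subseteq> cbox a b" using ptag that by blast+
        then have "u \<le> v" "a \<le> u" "v \<le> b" using uv by auto
        then show ?thesis using uv \<open>x \<in> K\<close> finep that by (auto simp: fine_def)
      qed
      define q where "q = {xK \<in> p. fst xK \<in> E}"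
      have "q \<subseteq> p" "finite q" using \<open>finite p\<close> by (auto simp: q_def)
      define g where "g = (\<lambda>(x,K). measure lborel K *\<^sub>R f' x - (F (Sup K) - F (Inf K)))"
      have disj: "{Inf (snd i)<..<Sup (snd i)} \<inter> {Inf (snd j)<..<Sup (snd j)} = {}"
        if "i \<in> p" "j \<in> p" "i \<noteq> j" for i j
      proof -
        have "interior (snd i) \<inter> interior (snd j) = {}"
          using tagged_division_ofD(5)[OF ptag, of "fst i" "snd i" "fst j" "snd j"] that
          by (auto simp: prod_eq_iff)
        moreover have "snd i = {Inf (snd i)..Sup (snd i)}" "snd j = {Inf (snd j)..Sup (snd j)}"
          using K[of "fst i" "snd i"] K[of "fst j" "snd j"] that by auto
        ultimately show ?thesis by (metis interior_atLeastAtMost_real)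
      qed
      have iq: "Inf (snd i) \<le> Sup (snd i) \<and> a \<le> Inf (snd i) \<and> Sup (snd i) \<le> b
                \<and> {Inf (snd i)<..<Sup (snd i)} \<subseteq> U" if "i \<in> q" for i
      proof -
        have i: "(fst i, snd i) \<in> p" "fst i \<in> E" using that by (auto simp: q_def)
        have "{Inf (snd i)<..<Sup (snd i)} \<subseteq> snd i" 
          using K[OF i(1)] by (metis greaterThanLessThan_subseteq_atLeastAtMost_iff order_refl)
        then show ?thesis using K[OF i(1)] dU[OF i(2)] by auto
      qed
      \<comment> \<open>Intervals tagged in \<open>E\<close> do not overlap and have their interiors
        in \<open>U\<close>, so their total length is below \<open>\<delta>\<close> and the choice
        of \<open>\<delta>\<close> bounds the increments of \<open>F\<close>.\<close>
      have "(\<Sum>i\<in>q. \<bar>F (Sup (snd i)) - F (Inf (snd i))\<bar>) < e'"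
      proof (rule \<delta>[rule_format])
        have "(\<Sum>i\<in>q. Sup (snd i) - Inf (snd i)) \<le> measure lebesgue U"
          using iq disj \<open>q \<subseteq> p\<close> \<open>finite q\<close> U
          by (intro sum_length_disjoint_le_measure) blast+
        then show "(\<Sum>i\<in>q. Sup (snd i) - Inf (snd i)) < \<delta>" using mU by simp
        show "{Inf (snd i)<..<Sup (snd i)} \<inter> {Inf (snd j)<..<Sup (snd j)} = {}"
          if "i \<in> q" "j \<in> q" "i \<noteq> j" for i j
          using that disj \<open>q \<subseteq> p\<close> by blast
      qed (use iq \<open>finite q\<close> in auto)
      moreover have "norm (sum g q) \<le> (\<Sum>i\<in>q. \<bar>F (Sup (snd i)) - F (Inf (snd i))\<bar>)"
        by (rule sum_norm_le) (auto simp: g_def q_def f'_def)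
      ultimately have gq: "norm (sum g q) \<le> e'" by linarith
      \<comment> \<open>The straddling estimate: the tag lies between the two ends, so the distances
        from the tag to the ends add up to the length of the interval.\<close>
      have "norm (sum g (p - q)) \<le> (\<Sum>i\<in>p-q. e/2 * (Sup (snd i) - Inf (snd i)))"
      proof (rule sum_norm_le)
        fix i assume "i \<in> p - q"
        then obtain x k where i: "i = (x,k)" "(x,k) \<in> p" "x \<notin> E" by (cases i) (auto simp: q_def)
        note k = K[OF i(2)]
        let ?u = "Inf k" and ?v = "Sup k"
        have uv: "?u \<in> k" "?v \<in> k" using k by (metis atLeastAtMost_iff order.trans order_refl)+
        then have "?u \<in> ball x (d x)" "?v \<in> ball x (d x)" using k by blast+
        then have du: "norm (?u - x) < d x" "norm (?v - x) < d x" by (auto simp: dist_norm norm_minus_commute)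
        have x: "x \<in> {a..b} - E" using k i by auto
        have 1: "norm (F ?u - F x - (?u-x) *\<^sub>R f x) \<le> e/2 * norm (?u-x)"
          using der'[OF x _ du(1)] k by auto
        have 2: "norm (F ?v - F x - (?v-x) *\<^sub>R f x) \<le> e/2 * norm (?v-x)"
          using der'[OF x _ du(2)] k by auto
        have mk: "measure lborel k = ?v - ?u" using k by (metis content_real order.trans)
        have "g i = (F ?u - F x - (?u-x) *\<^sub>R f x) - (F ?v - F x - (?v-x) *\<^sub>R f x)"
          using i(1,3) by (simp add: g_def f'_def mk) (simp add: algebra_simps)
        also have "norm \<dots> \<le> e/2 * norm (?u-x) + e/2 * norm (?v-x)"
          using 1 2 norm_triangle_ineq4 by (meson add_mono order_trans)
        also have "\<dots> = e/2 * (norm (?u-x) + norm (?v-x))"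
          by (simp add: distrib_left)
        also have "norm (?u-x) + norm (?v-x) = ?v - ?u"
          using k by simp
        finally show "norm (g i) \<le> e/2 * (Sup (snd i) - Inf (snd i))" using i by simp
      qed
      also have "\<dots> \<le> (\<Sum>i\<in>p. e/2 * (Sup (snd i) - Inf (snd i)))"
        using \<open>finite p\<close> \<open>e > 0\<close> K by (intro sum_mono2) fastforce+
      also have "\<dots> = e'"
        using ba(1) by (simp add: e'_def sum_distrib_left case_prod_unfold)
      finally have "norm (sum g (p - q)) \<le> e'" .
      moreover have "sum g p = sum g (p - q) + sum g q"
        using \<open>q \<subseteq> p\<close> \<open>finite p\<close> by (rule sum.subset_diff)
      ultimately have "norm (sum g p) \<le> e' + e'"
        using gq by (simp only: norm_triangle_mono)
      then show "norm ((\<Sum>(x, k)\<in>p. measure lborel k *\<^sub>R f' x) - (F b - F a)) \<le> e * measure lborel (cbox a b)"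
        using \<open>a < b\<close> ba(2) by (simp add: g_def e'_def sum_subtractf case_prod_unfold)
    qed
  qed
  then show ?thesis
    by (rule has_integral_spike[OF \<open>negligible E\<close>, rotated]) (auto simp: f'_def)
qed

section \<open>Restriction, continuity and products of absolutely continuous functions\<close>

lemma abs_continuous_on_interval_subset:
  assumes "abs_continuous_on_interval l u f" "l \<le> l'" "u' \<le> u"
  shows "abs_continuous_on_interval l' u' f"
  unfolding abs_continuous_on_interval_def
proof (intro allI impI)
  fix \<epsilon> :: real assume "\<epsilon> > 0"
  obtain \<delta> where "\<delta> > 0" and \<delta>: "\<forall>(I::nat set) a b. finite I \<longrightarrow>
      (\<forall>i\<in>I. l \<le> a i \<and> a i \<le> b i \<and> b i \<le> u) \<longrightarrow>
      (\<forall>i\<in>I. \<forall>j\<in>I. i \<noteq> j \<longrightarrow> {a i<..<b i} \<inter> {a j<..<b j} = {}) \<longrightarrow>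
      (\<Sum>i\<in>I. b i - a i) < \<delta> \<longrightarrow> (\<Sum>i\<in>I. \<bar>f (b i) - f (a i)\<bar>) < \<epsilon>"
    by (rule abs_continuous_family[OF assms(1) \<open>\<epsilon> > 0\<close>])
  show "\<exists>\<delta>>0. \<forall>(n::nat) (a :: nat \<Rightarrow> real) (b :: nat \<Rightarrow> real).
      (\<forall>i<n. l' \<le> a i \<and> a i \<le> b i \<and> b i \<le> u') \<longrightarrow>
      (\<forall>i<n. \<forall>j<n. i \<noteq> j \<longrightarrow> {a i<..<b i} \<inter> {a j<..<b j} = {}) \<longrightarrow>
      (\<Sum>i<n. b i - a i) < \<delta> \<longrightarrow> (\<Sum>i<n. \<bar>f (b i) - f (a i)\<bar>) < \<epsilon>"
  proof (intro exI conjI allI impI)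
    fix n :: nat and a b :: "nat \<Rightarrow> real"
    assume "\<forall>i<n. l' \<le> a i \<and> a i \<le> b i \<and> b i \<le> u'"
      "\<forall>i<n. \<forall>j<n. i \<noteq> j \<longrightarrow> {a i<..<b i} \<inter> {a j<..<b j} = {}"
      "(\<Sum>i<n. b i - a i) < \<delta>"
    then show "(\<Sum>i<n. \<bar>f (b i) - f (a i)\<bar>) < \<epsilon>"
      using assms(2,3) by (intro \<delta>[rule_format]) force+
  qed (fact \<open>\<delta> > 0\<close>)
qed

lemma abs_continuous_imp_continuous_on:
  assumes "abs_continuous_on_interval l u f"
  shows "continuous_on {l..u} f"
  unfolding continuous_on_iff
proof (intro ballI allI impI)
  fix x e :: real assume x: "x \<in> {l..u}" and "e > 0"
  obtain \<delta> where "\<delta> > 0" and \<delta>: "\<forall>(I::unit set) a b. finite I \<longrightarrow>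
      (\<forall>i\<in>I. l \<le> a i \<and> a i \<le> b i \<and> b i \<le> u) \<longrightarrow>
      (\<forall>i\<in>I. \<forall>j\<in>I. i \<noteq> j \<longrightarrow> {a i<..<b i} \<inter> {a j<..<b j} = {}) \<longrightarrow>
      (\<Sum>i\<in>I. b i - a i) < \<delta> \<longrightarrow> (\<Sum>i\<in>I. \<bar>f (b i) - f (a i)\<bar>) < e"
    by (rule abs_continuous_family[OF assms \<open>e > 0\<close>])
  have "dist (f y) (f x) < e" if "y \<in> {l..u}" "dist y x < \<delta>" for y
  proof (cases "x \<le> y")
    case True
    then have "(\<Sum>i\<in>{()}. \<bar>f y - f x\<bar>) < e"
      using that x by (intro \<delta>[rule_format]) (auto simp: dist_real_def)
    then show ?thesis by (simp add: dist_real_def)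
  next
    case False
    then have "(\<Sum>i\<in>{()}. \<bar>f x - f y\<bar>) < e"
      using that x by (intro \<delta>[rule_format]) (auto simp: dist_real_def)
    then show ?thesis by (simp add: dist_real_def abs_minus_commute)
  qed
  then show "\<exists>d>0. \<forall>x'\<in>{l..u}. dist x' x < d \<longrightarrow> dist (f x') (f x) < e"
    using \<open>\<delta> > 0\<close> by blast
qed

lemma continuous_on_Icc_bounded:
  fixes f :: "real \<Rightarrow> real"
  assumes "continuous_on {a..b} f"
  obtains B where "\<And>x. x \<in> {a..b} \<Longrightarrow> \<bar>f x\<bar> \<le> B"
proof -
  obtain B where "\<forall>y\<in>f ` {a..b}. norm y \<le> B"
    using compact_imp_bounded[OF compact_continuous_image[OF assms compact_Icc]]
    unfolding bounded_iff by (elim exE) (rule that)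
  then show ?thesis by (intro that) auto
qed

lemma abs_continuous_on_interval_lipschitz:
  assumes L: "\<And>x y. l \<le> x \<Longrightarrow> x \<le> y \<Longrightarrow> y \<le> u \<Longrightarrow> \<bar>f y - f x\<bar> \<le> L * (y - x)"
  shows "abs_continuous_on_interval l u f"
  unfolding abs_continuous_on_interval_def
proof (intro allI impI)
  fix \<epsilon> :: real assume "\<epsilon> > 0"
  show "\<exists>\<delta>>0. \<forall>(n::nat) (a :: nat \<Rightarrow> real) (b :: nat \<Rightarrow> real).
      (\<forall>i<n. l \<le> a i \<and> a i \<le> b i \<and> b i \<le> u) \<longrightarrow>
      (\<forall>i<n. \<forall>j<n. i \<noteq> j \<longrightarrow> {a i<..<b i} \<inter> {a j<..<b j} = {}) \<longrightarrow>
      (\<Sum>i<n. b i - a i) < \<delta> \<longrightarrow> (\<Sum>i<n. \<bar>f (b i) - f (a i)\<bar>) < \<epsilon>"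
  proof (intro exI conjI allI impI)
    \<comment> \<open>The summand 1 keeps the denominator positive; \<open>L\<close> may be zero, or
      even negative when the interval is degenerate.\<close>
    show "\<epsilon> / (\<bar>L\<bar> + 1) > 0" using \<open>\<epsilon> > 0\<close> by simp
    fix n :: nat and a b :: "nat \<Rightarrow> real"
    assume ab: "\<forall>i<n. l \<le> a i \<and> a i \<le> b i \<and> b i \<le> u"
      and less: "(\<Sum>i<n. b i - a i) < \<epsilon> / (\<bar>L\<bar> + 1)"
    have "(\<Sum>i<n. \<bar>f (b i) - f (a i)\<bar>) \<le> (\<Sum>i<n. (\<bar>L\<bar> + 1) * (b i - a i))"
    proof (rule sum_mono)
      fix i assume "i \<in> {..<n}"
      then have "\<bar>f (b i) - f (a i)\<bar> \<le> L * (b i - a i)" "a i \<le> b i" using ab L by auto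
      moreover have "L * (b i - a i) \<le> (\<bar>L\<bar> + 1) * (b i - a i)"
        using \<open>a i \<le> b i\<close> by (intro mult_right_mono) auto
      ultimately show "\<bar>f (b i) - f (a i)\<bar> \<le> (\<bar>L\<bar> + 1) * (b i - a i)" by linarith
    qed
    also have "\<dots> < \<epsilon>"
      using less by (simp add: sum_distrib_left[symmetric] pos_less_divide_eq mult.commute)
    finally show "(\<Sum>i<n. \<bar>f (b i) - f (a i)\<bar>) < \<epsilon>" .
  qed
qed

lemma abs_continuous_on_interval_mult:
  assumes f: "abs_continuous_on_interval l u f" and g: "abs_continuous_on_interval l u g"
  shows "abs_continuous_on_interval l u (\<lambda>x. f x * g x)"
proof -
  have bdd: "\<exists>M>0. \<forall>x\<in>{l..u}. \<bar>k x\<bar> \<le> M" if ac: "abs_continuous_on_interval l u k" for k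
  proof -
    obtain B where B: "\<And>x. x \<in> {l..u} \<Longrightarrow> \<bar>k x\<bar> \<le> B"
      by (rule continuous_on_Icc_bounded[OF abs_continuous_imp_continuous_on[OF ac]]) (rule that)
    \<comment> \<open>The bound is enlarged so that it is strictly positive and may be divided by
      below.\<close>
    have "\<bar>k x\<bar> \<le> \<bar>B\<bar> + 1" if "x \<in> {l..u}" for x using B[OF that] by linarith
    moreover have "\<bar>B\<bar> + 1 > 0" by simp
    ultimately show ?thesis by blast
  qed
  obtain M where M: "M > 0" "\<And>x. x \<in> {l..u} \<Longrightarrow> \<bar>f x\<bar> \<le> M" using bdd[OF f] by blast
  obtain M' where M': "M' > 0" "\<And>x. x \<in> {l..u} \<Longrightarrow> \<bar>g x\<bar> \<le> M'" using bdd[OF g] by blast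
  show ?thesis
    unfolding abs_continuous_on_interval_def
  proof (intro allI impI)
    fix \<epsilon> :: real assume "\<epsilon> > 0"
    obtain \<delta>1 where "\<delta>1 > 0" and \<delta>1: "\<forall>(I::nat set) a b. finite I \<longrightarrow>
        (\<forall>i\<in>I. l \<le> a i \<and> a i \<le> b i \<and> b i \<le> u) \<longrightarrow>
        (\<forall>i\<in>I. \<forall>j\<in>I. i \<noteq> j \<longrightarrow> {a i<..<b i} \<inter> {a j<..<b j} = {}) \<longrightarrow>
        (\<Sum>i\<in>I. b i - a i) < \<delta>1 \<longrightarrow> (\<Sum>i\<in>I. \<bar>f (b i) - f (a i)\<bar>) < \<epsilon> / (2 * M')"
      by (rule abs_continuous_family[OF f, of "\<epsilon> / (2 * M')"]) (use \<open>\<epsilon> > 0\<close> M'(1) in simp)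
    obtain \<delta>2 where "\<delta>2 > 0" and \<delta>2: "\<forall>(I::nat set) a b. finite I \<longrightarrow>
        (\<forall>i\<in>I. l \<le> a i \<and> a i \<le> b i \<and> b i \<le> u) \<longrightarrow>
        (\<forall>i\<in>I. \<forall>j\<in>I. i \<noteq> j \<longrightarrow> {a i<..<b i} \<inter> {a j<..<b j} = {}) \<longrightarrow>
        (\<Sum>i\<in>I. b i - a i) < \<delta>2 \<longrightarrow> (\<Sum>i\<in>I. \<bar>g (b i) - g (a i)\<bar>) < \<epsilon> / (2 * M)"
      by (rule abs_continuous_family[OF g, of "\<epsilon> / (2 * M)"]) (use \<open>\<epsilon> > 0\<close> M(1) in simp)
    show "\<exists>\<delta>>0. \<forall>(n::nat) (a :: nat \<Rightarrow> real) (b :: nat \<Rightarrow> real).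
        (\<forall>i<n. l \<le> a i \<and> a i \<le> b i \<and> b i \<le> u) \<longrightarrow>
        (\<forall>i<n. \<forall>j<n. i \<noteq> j \<longrightarrow> {a i<..<b i} \<inter> {a j<..<b j} = {}) \<longrightarrow>
        (\<Sum>i<n. b i - a i) < \<delta> \<longrightarrow> (\<Sum>i<n. \<bar>f (b i) * g (b i) - f (a i) * g (a i)\<bar>) < \<epsilon>"
    proof (intro exI conjI allI impI)
      show "min \<delta>1 \<delta>2 > 0" using \<open>\<delta>1 > 0\<close> \<open>\<delta>2 > 0\<close> by simp
      fix n :: nat and a b :: "nat \<Rightarrow> real"
      assume ab: "\<forall>i<n. l \<le> a i \<and> a i \<le> b i \<and> b i \<le> u"
        and dj: "\<forall>i<n. \<forall>j<n. i \<noteq> j \<longrightarrow> {a i<..<b i} \<inter> {a j<..<b j} = {}"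
        and less: "(\<Sum>i<n. b i - a i) < min \<delta>1 \<delta>2"
      have 1: "(\<Sum>i<n. \<bar>f (b i) - f (a i)\<bar>) < \<epsilon> / (2 * M')" using ab dj less by (intro \<delta>1[rule_format]) auto
      have 2: "(\<Sum>i<n. \<bar>g (b i) - g (a i)\<bar>) < \<epsilon> / (2 * M)" using ab dj less by (intro \<delta>2[rule_format]) auto
      have "(\<Sum>i<n. \<bar>f (b i) * g (b i) - f (a i) * g (a i)\<bar>)
        \<le> (\<Sum>i<n. M * \<bar>g (b i) - g (a i)\<bar> + M' * \<bar>f (b i) - f (a i)\<bar>)"
      proof (rule sum_mono)
        fix i assume "i \<in> {..<n}"
        then have "\<bar>f (b i)\<bar> \<le> M" "\<bar>g (a i)\<bar> \<le> M'" using ab M M' by auto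
        moreover have "f (b i) * g (b i) - f (a i) * g (a i)
          = f (b i) * (g (b i) - g (a i)) + g (a i) * (f (b i) - f (a i))"
          by (simp add: algebra_simps)
        moreover have "\<bar>f (b i) * (g (b i) - g (a i)) + g (a i) * (f (b i) - f (a i))\<bar>
           \<le> \<bar>f (b i)\<bar> * \<bar>g (b i) - g (a i)\<bar> + \<bar>g (a i)\<bar> * \<bar>f (b i) - f (a i)\<bar>"
          by (metis abs_mult abs_triangle_ineq)
        moreover have "\<dots> \<le> M * \<bar>g (b i) - g (a i)\<bar> + M' * \<bar>f (b i) - f (a i)\<bar>"
          using calculation(1,2) by (intro add_mono mult_right_mono) auto
        ultimately show "\<bar>f (b i) * g (b i) - f (a i) * g (a i)\<bar>
            \<le> M * \<bar>g (b i) - g (a i)\<bar> + M' * \<bar>f (b i) - f (a i)\<bar>" by linarith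
      qed
      also have "\<dots> = M * (\<Sum>i<n. \<bar>g (b i) - g (a i)\<bar>) + M' * (\<Sum>i<n. \<bar>f (b i) - f (a i)\<bar>)"
        by (simp add: sum.distrib sum_distrib_left)
      also have "\<dots> < \<epsilon> / 2 + \<epsilon> / 2"
        using mult_strict_left_mono[OF 1 M'(1)] mult_strict_left_mono[OF 2 M(1)] M(1) M'(1)
        by (intro add_strict_mono) auto
      finally show "(\<Sum>i<n. \<bar>f (b i) * g (b i) - f (a i) * g (a i)\<bar>) < \<epsilon>" by simp
    qed
  qed
qed

section \<open>Square-integrable derivatives\<close>

lemma finite_measure_lebesgue_on_Icc: "finite_measure (lebesgue_on {a..b::real})"
  by (rule finite_measure_lebesgue_on) simp

lemma integrable_lebesgue_on_Icc_bounded: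
  fixes f :: "real \<Rightarrow> real"
  assumes "f \<in> borel_measurable (lebesgue_on {a..b})" "\<And>x. x \<in> {a..b} \<Longrightarrow> \<bar>f x\<bar> \<le> B"
  shows "integrable (lebesgue_on {a..b}) f"
  by (rule finite_measure.integrable_const_bound[OF finite_measure_lebesgue_on_Icc, where B = B])
     (use assms in \<open>auto intro!: AE_I2\<close>)

lemma integrable_mult_square_integrable:
  fixes f g :: "'a \<Rightarrow> real"
  assumes [measurable]: "f \<in> borel_measurable M" "g \<in> borel_measurable M"
    and "integrable M (\<lambda>x. (f x)\<^sup>2)" "integrable M (\<lambda>x. (g x)\<^sup>2)"
  shows "integrable M (\<lambda>x. f x * g x)"
proof (rule Bochner_Integration.integrable_bound)
  show "integrable M (\<lambda>x. (f x)\<^sup>2 + (g x)\<^sup>2)" using assms by simp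
  have "\<bar>u * v\<bar> \<le> u\<^sup>2 + v\<^sup>2" for u v :: real
  proof -
    have "2 * (\<bar>u\<bar> * \<bar>v\<bar>) \<le> u\<^sup>2 + v\<^sup>2"
      using sum_squares_bound[of "\<bar>u\<bar>" "\<bar>v\<bar>"] by (simp add: mult.assoc)
    moreover have "0 \<le> \<bar>u\<bar> * \<bar>v\<bar>" by simp
    ultimately show ?thesis unfolding abs_mult by linarith
  qed
  then show "AE x in M. norm (f x * g x) \<le> norm ((f x)\<^sup>2 + (g x)\<^sup>2)" by simp
qed simp

text \<open>The Cauchy-Schwarz inequality for \<open>g\<close> of norm 1. With \<open>r\<close> the
  norm of \<open>f\<close>, the pointwise bound by
  \<open>(f x)\<^sup>2 / (2 * r) + r / 2 * (g x)\<^sup>2\<close> is weighted so that its integral is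
  exactly \<open>r / 2 + r / 2\<close>.\<close>

lemma abs_integral_mult_le:
  fixes f g :: "'a \<Rightarrow> real"
  assumes [measurable]: "f \<in> borel_measurable M" "g \<in> borel_measurable M"
    and f2: "integrable M (\<lambda>x. (f x)\<^sup>2)" and g2: "integrable M (\<lambda>x. (g x)\<^sup>2)"
    and pos: "(LINT x|M. (f x)\<^sup>2) > 0" and one: "(LINT x|M. (g x)\<^sup>2) = 1"
  shows "\<bar>LINT x|M. f x * g x\<bar> \<le> sqrt (LINT x|M. (f x)\<^sup>2)"
proof -
  define r where "r = sqrt (LINT x|M. (f x)\<^sup>2)"
  have r: "r > 0" "(LINT x|M. (f x)\<^sup>2) = r\<^sup>2" using pos by (auto simp: r_def)
  have fg: "integrable M (\<lambda>x. f x * g x)"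
    by (rule integrable_mult_square_integrable) (use f2 g2 in auto)
  have "\<bar>LINT x|M. f x * g x\<bar> \<le> (LINT x|M. \<bar>f x * g x\<bar>)"
    by (rule integral_abs_bound)
  also have "\<dots> \<le> (LINT x|M. (f x)\<^sup>2 / (2 * r) + r / 2 * (g x)\<^sup>2)"
  proof (rule integral_mono)
    fix x
    have "2 * \<bar>f x\<bar> * (r * \<bar>g x\<bar>) \<le> (f x)\<^sup>2 + r\<^sup>2 * (g x)\<^sup>2"
      using sum_squares_bound[of "\<bar>f x\<bar>" "r * \<bar>g x\<bar>"] by (simp add: power_mult_distrib)
    then show "\<bar>f x * g x\<bar> \<le> (f x)\<^sup>2 / (2 * r) + r / 2 * (g x)\<^sup>2"
      using r(1) by (simp add: abs_mult field_simps power2_eq_square)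
  qed (use fg f2 g2 in auto)
  also have "\<dots> = (LINT x|M. (f x)\<^sup>2) / (2 * r) + r / 2 * (LINT x|M. (g x)\<^sup>2)"
    using f2 g2 by simp
  also have "\<dots> = r" using r one by (simp add: power2_eq_square field_simps)
  finally show ?thesis by (simp add: r_def)
qed

text \<open>The fundamental theorem of calculus tolerates the finite set \<open>S\<close>, and the
  bound on the derivative then makes \<open>F\<close> Lipschitz.\<close>

lemma abs_continuous_on_interval_bounded_derivative:
  fixes F f :: "real \<Rightarrow> real"
  assumes cont: "continuous_on {l..u} F" and "finite S"
    and der: "\<And>x. x \<in> {l<..<u} - S \<Longrightarrow> (F has_real_derivative f x) (at x)"
    and B: "\<And>x. x \<in> {l..u} \<Longrightarrow> \<bar>f x\<bar> \<le> B"
  shows "abs_continuous_on_interval l u F"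
proof (rule abs_continuous_on_interval_lipschitz)
  fix x y assume xy: "l \<le> x" "x \<le> y" "y \<le> u"
  have "(f has_integral (F y - F x)) {x..y}"
    using xy der
    by (intro fundamental_theorem_of_calculus_interior_strong[OF \<open>finite S\<close>]
          continuous_on_subset[OF cont])
       (auto simp: has_real_derivative_iff_has_vector_derivative)
  moreover have "0 \<le> B" using B[of x] xy by fastforce
  ultimately have "norm (F y - F x) \<le> B * measure lborel {x..y}"
    using B xy by (intro has_integral_bound_real[where S="{}" and f = f]) auto
  then show "\<bar>F y - F x\<bar> \<le> B * (y - x)" using xy by simp
qed

lemma AE_lebesgue_on_not_in_finite:
  fixes S T :: "real set"
  assumes "finite S" "T \<in> sets lebesgue"
  shows "AE x in lebesgue_on T. x \<notin> S"
proof -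
  have "S \<in> null_sets lebesgue"
    using assms by (simp add: negligible_finite flip: negligible_iff_null_sets)
  then have "AE x in lebesgue. x \<notin> S" by (rule AE_not_in)
  then show ?thesis using assms by (auto simp: AE_restrict_space_iff)
qed

text \<open>The source of all concrete members of the space. The datum is \<open>g\<close>, which
  stands for \<open>F' + F\<close>, rather than the derivative, because the seminorm is the norm of
  \<open>g\<close>.\<close>

lemma W2_10_piecewise:
  fixes F g :: "real \<Rightarrow> real"
  assumes cont: "continuous_on {0..1} F" and S: "finite S"
    and der: "\<And>x. x \<in> {0<..<1} - S \<Longrightarrow> (F has_real_derivative (g x - F x)) (at x)"
    and g[measurable]: "g \<in> borel_measurable (lebesgue_on {0..1})"
    and B: "\<And>x. x \<in> {0..1} \<Longrightarrow> \<bar>g x\<bar> \<le> B"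
  shows "F \<in> W2_10"
    and "W2_10_norm F = sqrt (LINT x|lebesgue_on {0..1}. (g x)\<^sup>2)"
    and "AE x in lebesgue_on {0..1}. deriv F x + F x = g x"
proof -
  let ?M = "lebesgue_on {0..1::real}"
  have F[measurable]: "F \<in> borel_measurable ?M"
    by (rule continuous_imp_measurable_on_sets_lebesgue[OF cont]) simp
  obtain M where M: "\<And>x. x \<in> {0..1} \<Longrightarrow> \<bar>F x\<bar> \<le> M"
    by (rule continuous_on_Icc_bounded[OF cont]) (rule that)
  have bd: "\<bar>g x - F x\<bar> \<le> B + M" if "x \<in> {0..1}" for x
    using M[OF that] B[OF that] by linarith
  \<comment> \<open>The endpoints join the exceptional set, since the derivative is given only on
    the open interval.\<close>
  define T where "T = S \<union> {0,1}"
  have T: "finite T" using S by (simp add: T_def)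
  have derT: "(F has_real_derivative (g x - F x)) (at x)" if "x \<in> {0..1}" "x \<notin> T" for x
    using der[of x] that by (auto simp: T_def)
  then have deqT: "deriv F x = g x - F x" if "x \<in> {0..1}" "x \<notin> T" for x
    using that DERIV_imp_deriv by blast
  have AET: "AE x in ?M. x \<in> {0..1} \<and> x \<notin> T"
    using AE_lebesgue_on_not_in_finite[OF T, of "{0..1}"] AE_space[of ?M] by auto
  have AE1: "AE x in ?M. deriv F x = g x - F x"
    using AET by eventually_elim (use deqT in blast)
  then show AE2: "AE x in ?M. deriv F x + F x = g x"
    by eventually_elim simp
  \<comment> \<open>At the points of \<open>T\<close> the value of \<open>deriv F\<close> is
    unknown, but changing a function at countably many points preserves measurability.\<close>
  have meas[measurable]: "deriv F \<in> borel_measurable ?M"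
  proof (rule measurable_discrete_difference)
    show "(\<lambda>x. g x - F x) \<in> borel_measurable ?M" by simp
    show "countable (T \<inter> {0..1})" using T by (simp add: countable_finite)
    show "{x} \<in> sets ?M" if "x \<in> T \<inter> {0..1}" for x
      using that by (auto simp: sets_restrict_space)
  qed (use deqT in auto)
  have "integrable ?M (\<lambda>x. (g x - F x)\<^sup>2)"
  proof (rule integrable_lebesgue_on_Icc_bounded)
    show "\<bar>(g x - F x)\<^sup>2\<bar> \<le> (B + M)\<^sup>2" if "x \<in> {0..1}" for x
      using power_mono[OF bd[OF that], of 2] by simp
  qed simp
  then have "integrable ?M (\<lambda>x. (deriv F x)\<^sup>2)"
    by (rule integrable_cong_AE_imp) (use AE1 in auto)
  moreover have "AE x in ?M. F field_differentiable (at x)"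
    using AET by eventually_elim (use derT in \<open>auto simp: field_differentiable_def\<close>)
  moreover have "abs_continuous_on_interval 0 1 F"
    using cont S der bd by (rule abs_continuous_on_interval_bounded_derivative)
  ultimately show "F \<in> W2_10" by (simp add: W2_10_def square_integrable_01_def)
  have "(LINT x|?M. (deriv F x + F x)\<^sup>2) = (LINT x|?M. (g x)\<^sup>2)"
    by (rule integral_cong_AE) (use AE2 in auto)
  then show "W2_10_norm F = sqrt (LINT x|?M. (g x)\<^sup>2)" by (simp add: W2_10_norm_def)
qed

section \<open>Integrability and differentiability in \<open>W2_10\<close>\<close>

lemma W2_10_continuous_on: "\<phi> \<in> W2_10 \<Longrightarrow> continuous_on {0..1} \<phi>"
  by (auto simp: W2_10_def intro: abs_continuous_imp_continuous_on)

lemma W2_10_integrable: "\<phi> \<in> W2_10 \<Longrightarrow> integrable (lebesgue_on {0..1}) \<phi>"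
  by (intro continuous_imp_integrable_real W2_10_continuous_on)

lemma W2_10_deriv_plus_self:
  assumes "\<phi> \<in> W2_10"
  shows "(\<lambda>x. deriv \<phi> x + \<phi> x) \<in> borel_measurable (lebesgue_on {0..1})"
    and "integrable (lebesgue_on {0..1}) (\<lambda>x. (deriv \<phi> x + \<phi> x)\<^sup>2)"
proof -
  let ?M = "lebesgue_on {0..1::real}"
  note cont = W2_10_continuous_on[OF assms]
  have [measurable]: "\<phi> \<in> borel_measurable ?M" "deriv \<phi> \<in> borel_measurable ?M"
    using assms W2_10_integrable[OF assms] by (auto simp: W2_10_def square_integrable_01_def)
  show meas[measurable]: "(\<lambda>x. deriv \<phi> x + \<phi> x) \<in> borel_measurable ?M" by simp
  have "integrable ?M (\<lambda>x. (\<phi> x)\<^sup>2)"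
    by (intro continuous_imp_integrable_real continuous_intros cont)
  moreover have "integrable ?M (\<lambda>x. (deriv \<phi> x)\<^sup>2)"
    using assms by (simp add: W2_10_def square_integrable_01_def)
  ultimately have "integrable ?M (\<lambda>x. 2 * (deriv \<phi> x)\<^sup>2 + 2 * (\<phi> x)\<^sup>2)" by simp
  then show "integrable ?M (\<lambda>x. (deriv \<phi> x + \<phi> x)\<^sup>2)"
  proof (rule Bochner_Integration.integrable_bound)
    have "(u + v)\<^sup>2 \<le> 2 * u\<^sup>2 + 2 * v\<^sup>2" for u v :: real
      using sum_squares_bound[of u v] by (simp add: power2_sum)
    then show "AE x in ?M. norm ((deriv \<phi> x + \<phi> x)\<^sup>2) \<le> norm (2 * (deriv \<phi> x)\<^sup>2 + 2 * (\<phi> x)\<^sup>2)"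
      by simp
  qed simp
qed

lemma W2_10_negligible_not_differentiable:
  assumes "\<phi> \<in> W2_10"
  shows "negligible {x \<in> {0..1}. \<not> \<phi> field_differentiable (at x)}"
proof -
  have "AE x in lebesgue. x \<in> {0..1} \<longrightarrow> \<phi> field_differentiable (at x)"
    using assms by (simp add: W2_10_def AE_restrict_space_iff)
  then obtain Z where Z: "Z \<in> null_sets lebesgue"
    "{x \<in> space lebesgue. \<not> (x \<in> {0..1} \<longrightarrow> \<phi> field_differentiable (at x))} \<subseteq> Z"
    unfolding eventually_ae_filter by (elim bexE) (rule that)
  from Z(1) have "negligible Z" by (simp only: negligible_iff_null_sets)
  moreover have "{x \<in> {0..1}. \<not> \<phi> field_differentiable (at x)} \<subseteq> Z"
    using Z(2) by simp
  ultimately show ?thesis by (rule negligible_subset)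
qed

section \<open>Error functionals and error norms\<close>

lemma error_norm_ge:
  "\<phi> \<in> W2_10 \<Longrightarrow> W2_10_norm \<phi> = 1 \<Longrightarrow> ereal \<bar>error_functional N C \<phi>\<bar> \<le> error_norm N C"
  unfolding error_norm_def by (intro SUP_upper) auto

lemma error_norm_cong:
  assumes "\<And>\<beta>. \<beta> \<le> N \<Longrightarrow> C \<beta> = D \<beta>"
  shows "error_norm N C = error_norm N D"
proof -
  have "error_functional N C = error_functional N D"
    using assms by (auto simp: error_functional_def fun_eq_iff intro!: sum.cong)
  then show ?thesis by (simp add: error_norm_def)
qed

lemma error_functional_linear:
  assumes "integrable (lebesgue_on {0..1}) f" "integrable (lebesgue_on {0..1}) g"
  shows "error_functional N C (\<lambda>x. a * f x + b * g x) =
    a * error_functional N C f + b * error_functional N C g"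
  using assms by (simp add: error_functional_def sum.distrib sum_distrib_left algebra_simps)

text \<open>Each interior node is shared by two cells and each end node belongs to one, which is
  where the doubled interior weights come from.\<close>

lemma sum_trapezoidal:
  fixes f :: "nat \<Rightarrow> real"
  assumes "N \<ge> 1"
  shows "(\<Sum>\<beta>=0..N. (if \<beta> = 0 \<or> \<beta> = N then c else 2 * c) * f \<beta>) =
    c * (\<Sum>k<N. f k + f (Suc k))"
proof -
  have "(\<Sum>\<beta>=0..N. (if \<beta> = 0 \<or> \<beta> = N then c else 2 * c) * f \<beta>) =
    (\<Sum>\<beta>\<le>N. 2 * c * f \<beta> - (if \<beta> = 0 then c * f \<beta> else 0) - (if \<beta> = N then c * f \<beta> else 0))"
    using assms by (intro sum.cong) auto
  also have "\<dots> = c * ((\<Sum>\<beta>\<le>N. f \<beta>) - f N) + c * ((\<Sum>\<beta>\<le>N. f \<beta>) - f 0)"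
    by (simp add: sum_subtractf flip: sum_distrib_left) (simp add: algebra_simps)
  also have "(\<Sum>\<beta>\<le>N. f \<beta>) - f N = (\<Sum>k<N. f k)"
    by (simp flip: lessThan_Suc_atMost)
  also have "(\<Sum>\<beta>\<le>N. f \<beta>) - f 0 = (\<Sum>k<N. f (Suc k))"
    by (simp add: sum.lessThan_Suc_shift flip: lessThan_Suc_atMost del: sum.lessThan_Suc)
  finally show ?thesis by (simp add: sum.distrib algebra_simps)
qed

lemma tanh_half_eq: "tanh (x / 2) = (exp x - 1) / (exp x + 1)" for x :: real
proof -
  have "exp x > 0" by simp
  then show ?thesis
    by (simp add: tanh_real_altdef exp_minus divide_simps)
qed

section \<open>The kernel of the optimal error functional\<close>

text \<open>The signed distance of \<open>x\<close> from the midpoint of its mesh cell \<open>[k h, (k + 1) h)\<close>.\<close>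
definition cell_offset :: "real \<Rightarrow> real \<Rightarrow> real" where
  "cell_offset h x = x - h * of_int \<lfloor>x / h\<rfloor> - h / 2"

text \<open>The factor \<open>1 / cosh (h / 2)\<close> is the solution \<open>a\<close> of the
  orthogonality condition: the integral of \<open>exp u * (1 - a * exp u)\<close> over
  \<open>{- h / 2..h / 2}\<close> is \<open>2 * sinh (h / 2) - a * sinh h\<close>.\<close>

definition error_kernel :: "real \<Rightarrow> real \<Rightarrow> real" where
  "error_kernel h x = 1 - exp (cell_offset h x) / cosh (h / 2)"

text \<open>On each cell this is the solution of \<phi>' + \<phi> = \<open>error_kernel h\<close>
  that vanishes at both ends.\<close>

definition extremal_function :: "real \<Rightarrow> real \<Rightarrow> real" where
  "extremal_function h x = 1 - cosh (cell_offset h x) / cosh (h / 2)"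

locale uniform_mesh =
  fixes N :: nat and h :: real
  assumes N: "N \<ge> 1" and h: "h = 1 / real N"
begin

lemma h_pos: "h > 0" and N_h: "real N * h = 1"
  using N h by auto

lemma cell_offset_eq:
  assumes "real k * h \<le> x" "x < (real k + 1) * h"
  shows "cell_offset h x = x - real k * h - h / 2"
proof -
  have "\<lfloor>x / h\<rfloor> = int k"
    using assms h_pos by (intro floor_unique) (auto simp: field_simps)
  then show ?thesis by (simp add: cell_offset_def mult.commute)
qed

lemma abs_cell_offset_le: "\<bar>cell_offset h x\<bar> \<le> h / 2"
proof -
  have "of_int \<lfloor>x / h\<rfloor> * h \<le> x" "x < (of_int \<lfloor>x / h\<rfloor> + 1) * h"
    using h_pos by (simp_all flip: pos_le_divide_eq pos_divide_less_eq)
  then have "h * of_int \<lfloor>x / h\<rfloor> \<le> x" "x \<le> h * of_int \<lfloor>x / h\<rfloor> + h"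
    by (simp_all add: algebra_simps)
  then show ?thesis by (simp add: cell_offset_def abs_le_iff field_simps)
qed

lemma cell_cover:
  assumes "x \<in> {0..1}"
  obtains k where "k < N" "x \<in> {real k * h..(real k + 1) * h}"
\<comment> \<open>For \<open>x = 1\<close> the floor would give the index \<open>N\<close>, so the
  last closed cell is taken instead.\<close>
proof (cases "x = 1")
  case True
  have "real (N - 1) + 1 = real N" using N by simp
  then have "1 = (real (N - 1) + 1) * h" "real (N - 1) * h \<le> 1"
    using N_h h_pos by (auto simp: algebra_simps)
  then show ?thesis using that[of "N - 1"] True N by auto
next
  case False
  define k where "k = nat \<lfloor>x / h\<rfloor>"
  have "x / h \<ge> 0" using assms h_pos by simp
  then have "real k \<le> x / h" "x / h < real k + 1"
    unfolding k_def by (simp_all add: floor_correct)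
  then have k: "real k * h \<le> x" "x < (real k + 1) * h"
    using h_pos by (auto simp: field_simps)
  have "real k * h < real N * h" using k(1) False assms N_h by auto
  then have "k < N" using h_pos by simp
  then show ?thesis using k that[of k] by auto
qed

lemma error_kernel_eq:
  assumes "real k * h \<le> x" "x < (real k + 1) * h"
  shows "error_kernel h x = 1 - exp (x - real k * h - h / 2) / cosh (h / 2)"
  using cell_offset_eq[OF assms] by (simp add: error_kernel_def)

text \<open>At the right end of the cell the floor has already moved on, so the offset is
  \<open>- h / 2\<close> instead of \<open>h / 2\<close>; since \<open>cosh\<close> is even, the
  formula persists. Hence the cell formulas fit together continuously, while the kernel itself jumps
  at the nodes.\<close>

lemma extremal_function_eq:
  assumes "x \<in> {real k * h..(real k + 1) * h}"
  shows "extremal_function h x = 1 - cosh (x - real k * h - h / 2) / cosh (h / 2)"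
proof (cases "x = (real k + 1) * h")
  case True
  have "cell_offset h x = - (h / 2)"
    using cell_offset_eq[of "Suc k" x] h_pos by (simp add: True algebra_simps)
  moreover have "x - real k * h - h / 2 = h / 2" by (simp add: True algebra_simps)
  ultimately show ?thesis by (simp only: extremal_function_def cosh_minus)
next
  case False
  then show ?thesis using assms cell_offset_eq[of k x] by (simp add: extremal_function_def)
qed

lemma extremal_function_node: "extremal_function h (real k * h) = 0"
  using extremal_function_eq[of "real k * h" k] h_pos by (simp add: algebra_simps)

lemma extremal_function_nonneg: "extremal_function h x \<ge> 0"
proof -
  have "cosh \<bar>cell_offset h x\<bar> \<le> cosh (h / 2)"
    using abs_cell_offset_le h_pos by (subst cosh_real_nonneg_le_iff) auto
  then show ?thesis by (simp add: extremal_function_def cosh_real_abs divide_le_eq)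
qed

lemma extremal_function_midpoint: "extremal_function h (h / 2) > 0"
proof -
  have "cell_offset h (h / 2) = 0" using cell_offset_eq[of 0 "h / 2"] h_pos by simp
  moreover have "cosh 0 < cosh (h / 2)"
    using h_pos by (subst cosh_real_nonneg_less_iff) auto
  ultimately show ?thesis by (simp add: extremal_function_def)
qed

lemma continuous_on_extremal_function: "continuous_on {0..1} (extremal_function h)"
proof -
  have "continuous_on (\<Union>k\<in>{..<N}. {real k * h..(real k + 1) * h}) (extremal_function h)"
  proof (rule continuous_on_closed_Union)
    fix k
    have "continuous_on {real k * h..(real k + 1) * h} (\<lambda>x. 1 - cosh (x - real k * h - h / 2) / cosh (h / 2))"
      by (intro continuous_intros) simp
    then show "continuous_on {real k * h..(real k + 1) * h} (extremal_function h)"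
      by (rule continuous_on_eq) (simp add: extremal_function_eq)
  qed auto
  then show ?thesis
    by (rule continuous_on_subset) (auto elim: cell_cover)
qed

lemma error_kernel_measurable [measurable]: "error_kernel h \<in> borel_measurable borel"
  unfolding error_kernel_def[abs_def] cell_offset_def[abs_def] by measurable

lemma error_kernel_measurable_lebesgue_on [measurable]:
  "error_kernel h \<in> borel_measurable (lebesgue_on A)"
  by (intro measurable_restrict_space1 measurable_completion) simp

lemma abs_error_kernel_le: "\<bar>error_kernel h x\<bar> \<le> 1 + exp (h / 2)"
proof -
  have "exp (cell_offset h x) \<le> exp (h / 2)" using abs_cell_offset_le[of x] by auto
  moreover have "exp (cell_offset h x) / cosh (h / 2) \<le> exp (cell_offset h x) / 1"
    using cosh_real_ge_1[of "h / 2"] by (intro divide_left_mono) auto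
  moreover have "0 \<le> exp (cell_offset h x) / cosh (h / 2)" by simp
  ultimately show ?thesis unfolding error_kernel_def by linarith
qed

lemma error_kernel_square_integrable: "integrable (lebesgue_on {0..1}) (\<lambda>x. (error_kernel h x)\<^sup>2)"
proof (rule integrable_lebesgue_on_Icc_bounded)
  show "\<bar>(error_kernel h x)\<^sup>2\<bar> \<le> (1 + exp (h / 2))\<^sup>2" for x
    using power_mono[OF abs_error_kernel_le[of x], of 2] by simp
qed simp

lemma extremal_function_deriv:
  assumes "x \<in> {0<..<1} - (\<lambda>k. real k * h) ` {..N}"
  shows "(extremal_function h has_real_derivative (error_kernel h x - extremal_function h x)) (at x)"
proof -
  obtain k where k: "k < N" "x \<in> {real k * h..(real k + 1) * h}"
    using assms cell_cover[of x] by auto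
  have "real k * h \<in> (\<lambda>k. real k * h) ` {..N}" "real (Suc k) * h \<in> (\<lambda>k. real k * h) ` {..N}"
    by (rule imageI, use k(1) in simp)+
  then have "x \<noteq> real k * h" "x \<noteq> real (Suc k) * h" using assms by auto
  then have x: "x \<in> {real k * h<..<(real k + 1) * h}" using k by (auto simp: algebra_simps)
  let ?u = "x - real k * h - h / 2"
  have "((\<lambda>x. 1 - cosh (x - real k * h - h / 2) / cosh (h / 2)) has_real_derivative
      - sinh ?u / cosh (h / 2)) (at x)"
    by (auto intro!: derivative_eq_intros)
  moreover have "- sinh ?u / cosh (h / 2) = error_kernel h x - extremal_function h x"
    using x extremal_function_eq[of x k] error_kernel_eq[of k x]
    by (simp add: add_divide_distrib flip: cosh_plus_sinh)
  ultimately have "((\<lambda>x. 1 - cosh (x - real k * h - h / 2) / cosh (h / 2)) has_real_derivative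
      (error_kernel h x - extremal_function h x)) (at x)" by (simp only:)
  then show ?thesis
    by (rule has_field_derivative_transform_within_open[OF _ open_greaterThanLessThan x])
       (subst extremal_function_eq[of _ k], auto)
qed

text \<open>Inside the cell the kernel satisfies \<open>K' = K - 1\<close>, so the integrand is the
  derivative of \<open>K \<phi>\<close>. The boundary values of \<open>K\<close> produce the
  right-hand side.\<close>

lemma error_kernel_cell_integral:
  assumes \<phi>: "\<phi> \<in> W2_10" and "k < N"
  shows "((\<lambda>x. error_kernel h x * (deriv \<phi> x + \<phi> x) - \<phi> x) has_integral
      - tanh (h / 2) * (\<phi> (real k * h) + \<phi> (real (Suc k) * h))) {real k * h..real (Suc k) * h}"
proof -
  let ?a = "real k * h" and ?b = "real (Suc k) * h"
  \<comment> \<open>The smooth formula for the kernel on the whole closed cell. At the right end it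
    gives the left limit, whereas \<open>error_kernel\<close> takes the value of the next cell
    there; one point does not affect the integral.\<close>
  define w where "w x = 1 - exp (x - ?a - h / 2) / cosh (h / 2)" for x
  have ab: "0 \<le> ?a" "?a < ?b" "?b \<le> 1"
    using h_pos mult_right_mono[of "real (Suc k)" "real N" h] \<open>k < N\<close> N_h by auto
  have w': "(w has_real_derivative (w x - 1)) (at x)" for x
    unfolding w_def by (auto intro!: derivative_eq_intros)
  have wa: "w ?a = tanh (h / 2)" and wb: "w ?b = - tanh (h / 2)"
    by (simp_all add: w_def tanh_def field_simps flip: cosh_plus_sinh cosh_minus_sinh)
  have cont_w: "continuous_on A w" for A
    unfolding w_def by (intro continuous_intros) simp
  have "continuous_on {?a..?b} (\<lambda>x. w x - 1)" by (intro continuous_intros cont_w)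
  then obtain B where "\<And>x. x \<in> {?a..?b} \<Longrightarrow> \<bar>w x - 1\<bar> \<le> B"
    by (rule continuous_on_Icc_bounded) (rule that)
  then have "abs_continuous_on_interval ?a ?b w"
    using cont_w w' by (intro abs_continuous_on_interval_bounded_derivative[where S = "{}"]) auto
  moreover have "abs_continuous_on_interval ?a ?b \<phi>"
    using \<phi> ab abs_continuous_on_interval_subset[of 0 1 \<phi> ?a ?b] by (auto simp: W2_10_def)
  ultimately have ac: "abs_continuous_on_interval ?a ?b (\<lambda>x. w x * \<phi> x)"
    by (rule abs_continuous_on_interval_mult)
  have int_w: "((\<lambda>x. w x * (deriv \<phi> x + \<phi> x) - \<phi> x) has_integral (w ?b * \<phi> ?b - w ?a * \<phi> ?a)) {?a..?b}"
  proof (rule fundamental_theorem_of_calculus_abs_continuous[OF ac ab(2)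
        W2_10_negligible_not_differentiable[OF \<phi>]])
    fix x assume x: "x \<in> {?a..?b} - {x \<in> {0..1}. \<not> \<phi> field_differentiable at x}"
    then have "(\<phi> has_real_derivative deriv \<phi> x) (at x)"
      using ab by (auto simp: DERIV_deriv_iff_field_differentiable)
    then have "((\<lambda>x. w x * \<phi> x) has_real_derivative
        (w x * (deriv \<phi> x + \<phi> x) - \<phi> x)) (at x)"
      by (auto intro!: derivative_eq_intros w' simp: algebra_simps)
    then show "((\<lambda>x. w x * \<phi> x) has_vector_derivative
        (w x * (deriv \<phi> x + \<phi> x) - \<phi> x)) (at x within {?a..?b})"
      by (simp add: has_real_derivative_iff_has_vector_derivative has_vector_derivative_at_within)
  qed
  have kernel_w: "error_kernel h x = w x" if "x \<in> {?a..?b} - {?b}" for x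
    unfolding w_def using that by (intro error_kernel_eq) (auto simp: algebra_simps)
  have "((\<lambda>x. error_kernel h x * (deriv \<phi> x + \<phi> x) - \<phi> x) has_integral
      (w ?b * \<phi> ?b - w ?a * \<phi> ?a)) {?a..?b}"
    by (rule has_integral_spike_finite[of "{?b}", OF _ _ int_w]) (simp_all only: kernel_w finite.intros)
  moreover have "w ?b * \<phi> ?b - w ?a * \<phi> ?a = - tanh (h / 2) * (\<phi> ?a + \<phi> ?b)"
    unfolding wa wb by (simp add: algebra_simps)
  ultimately show ?thesis by (simp only:)
qed

lemma error_kernel_integral:
  assumes \<phi>: "\<phi> \<in> W2_10"
  shows "(LINT x|lebesgue_on {0..1}. error_kernel h x * (deriv \<phi> x + \<phi> x)) =
    (LINT x|lebesgue_on {0..1}. \<phi> x)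
      - tanh (h / 2) * (\<Sum>k<N. \<phi> (real k * h) + \<phi> (real (Suc k) * h))"
proof -
  let ?M = "lebesgue_on {0..1::real}"
  let ?G = "\<lambda>x. error_kernel h x * (deriv \<phi> x + \<phi> x) - \<phi> x"
  have "(?G has_integral - tanh (h / 2) * (\<Sum>k<n. \<phi> (real k * h) + \<phi> (real (Suc k) * h))) {0..real n * h}"
    if "n \<le> N" for n
    using that
  proof (induction n)
    case (Suc n)
    have "(?G has_integral - tanh (h / 2) * (\<Sum>k<n. \<phi> (real k * h) + \<phi> (real (Suc k) * h))
        + - tanh (h / 2) * (\<phi> (real n * h) + \<phi> (real (Suc n) * h))) {0..real (Suc n) * h}"
      using Suc h_pos
      by (intro has_integral_combine[of _ "real n * h"] error_kernel_cell_integral[OF \<phi>] Suc.IH) auto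
    then show ?case by (simp only: sum.lessThan_Suc distrib_left)
  qed (simp add: has_integral_refl)
  from this[OF order_refl]
  have hk: "(?G has_integral - tanh (h / 2) * (\<Sum>k<N. \<phi> (real k * h) + \<phi> (real (Suc k) * h))) {0..1}"
    by (simp only: N_h)
  note meas [measurable] = W2_10_deriv_plus_self(1)[OF \<phi>]
  have int: "integrable ?M (\<lambda>x. error_kernel h x * (deriv \<phi> x + \<phi> x))"
    by (intro integrable_mult_square_integrable error_kernel_measurable_lebesgue_on error_kernel_square_integrable W2_10_deriv_plus_self \<phi>)
  \<comment> \<open>The cells were added up as gauge integrals; integrability of both terms
    identifies the total with the Lebesgue integral and allows it to be split.\<close>
  have "(?G has_integral (LINT x|?M. ?G x)) {0..1}"
    using int W2_10_integrable[OF \<phi>] by (intro has_integral_integral_lebesgue_on) auto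
  with hk have "(LINT x|?M. ?G x) = - tanh (h / 2) * (\<Sum>k<N. \<phi> (real k * h) + \<phi> (real (Suc k) * h))"
    by (rule has_integral_unique[rotated])
  then show ?thesis using int W2_10_integrable[OF \<phi>] by simp
qed

section \<open>The error functional of the optimal coefficients and its norm\<close>

definition optimal_coeff :: "nat \<Rightarrow> real" where
  "optimal_coeff \<beta> = (if \<beta> = 0 \<or> \<beta> = N then tanh (h / 2) else 2 * tanh (h / 2))"

definition kernel_norm_sq :: real where
  "kernel_norm_sq = (LINT x|lebesgue_on {0..1}. (error_kernel h x)\<^sup>2)"

lemma error_functional_alt:
  "error_functional N C \<phi> = (LINT x|lebesgue_on {0..1}. \<phi> x) - (\<Sum>\<beta>=0..N. C \<beta> * \<phi> (real \<beta> * h))"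
  by (simp add: error_functional_def h mult.commute)

text \<open>A Riesz representation: in terms of \<phi>' + \<phi>, the functional is the
  \<open>L\<^sub>2\<close> inner product with the kernel.\<close>

lemma error_functional_optimal_coeff:
  assumes "\<phi> \<in> W2_10"
  shows "error_functional N optimal_coeff \<phi> =
    (LINT x|lebesgue_on {0..1}. error_kernel h x * (deriv \<phi> x + \<phi> x))"
  unfolding error_kernel_integral[OF assms] error_functional_alt optimal_coeff_def
  using sum_trapezoidal[OF N, of "tanh (h / 2)" "\<lambda>k. \<phi> (real k * h)"] by simp

text \<open>These are the test functions of the variational argument: \<open>s\<close> is the size
  of the perturbation, \<open>t\<close> makes room for normalisation. Polynomials are enough as
  perturbations because they can separate the nodes.\<close>

lemma extremal_function_combination:
  fixes p :: "real poly" and t s :: real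
  defines "F \<equiv> \<lambda>x. t * extremal_function h x + s * poly p x"
    and "g \<equiv> \<lambda>x. t * error_kernel h x + s * poly (pderiv p + p) x"
  shows "F \<in> W2_10"
    and "W2_10_norm F = sqrt (LINT x|lebesgue_on {0..1}. (g x)\<^sup>2)"
    and "AE x in lebesgue_on {0..1}. deriv F x + F x = g x"
proof -
  have "continuous_on {0..1} (poly (pderiv p + p))" by (intro continuous_intros)
  then obtain B where B: "\<And>x. x \<in> {0..1} \<Longrightarrow> \<bar>poly (pderiv p + p) x\<bar> \<le> B"
    by (rule continuous_on_Icc_bounded) (rule that)
  have cont: "continuous_on {0..1} F"
    unfolding F_def by (intro continuous_intros continuous_on_extremal_function)
  have fin: "finite ((\<lambda>k. real k * h) ` {..N})" by simp
  have der: "(F has_real_derivative (g x - F x)) (at x)"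
    if "x \<in> {0<..<1} - (\<lambda>k. real k * h) ` {..N}" for x
    unfolding F_def
    by (rule derivative_eq_intros extremal_function_deriv[OF that] refl)+
       (simp add: g_def F_def algebra_simps)
  have [measurable]: "poly (pderiv p + p) \<in> borel_measurable (lebesgue_on {0..1})"
    by (intro continuous_imp_measurable_on_sets_lebesgue continuous_intros) simp
  have meas: "g \<in> borel_measurable (lebesgue_on {0..1})"
    unfolding g_def by measurable
  have bound: "\<bar>g x\<bar> \<le> \<bar>t\<bar> * (1 + exp (h / 2)) + \<bar>s\<bar> * B" if "x \<in> {0..1}" for x
  proof -
    have "\<bar>g x\<bar> \<le> \<bar>t\<bar> * \<bar>error_kernel h x\<bar> + \<bar>s\<bar> * \<bar>poly (pderiv p + p) x\<bar>"
      unfolding g_def by (metis abs_mult abs_triangle_ineq)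
    also have "\<dots> \<le> \<bar>t\<bar> * (1 + exp (h / 2)) + \<bar>s\<bar> * B"
      using abs_error_kernel_le B[OF that] by (intro add_mono mult_left_mono) auto
    finally show ?thesis .
  qed
  note facts = W2_10_piecewise[OF cont fin der meas bound]
  show "F \<in> W2_10" by (rule facts(1))
  show "W2_10_norm F = sqrt (LINT x|lebesgue_on {0..1}. (g x)\<^sup>2)" by (rule facts(2))
  show "AE x in lebesgue_on {0..1}. deriv F x + F x = g x" by (rule facts(3))
qed

lemma extremal_function_W2_10: "extremal_function h \<in> W2_10"
  and extremal_function_AE:
    "AE x in lebesgue_on {0..1}. deriv (extremal_function h) x + extremal_function h x = error_kernel h x"
  using extremal_function_combination[of 1 0 0] by simp_all

lemma error_functional_extremal_function: "error_functional N C (extremal_function h) = kernel_norm_sq"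
proof -
  let ?M = "lebesgue_on {0..1::real}"
  note [measurable] = W2_10_deriv_plus_self(1)[OF extremal_function_W2_10]
  have "error_functional N C (extremal_function h) = (LINT x|?M. extremal_function h x)" for C
    unfolding error_functional_alt by (simp add: extremal_function_node)
  then have "error_functional N C (extremal_function h) =
      error_functional N optimal_coeff (extremal_function h)" by simp
  also have "\<dots> = (LINT x|?M. error_kernel h x * (deriv (extremal_function h) x + extremal_function h x))"
    by (rule error_functional_optimal_coeff[OF extremal_function_W2_10])
  also have "\<dots> = kernel_norm_sq"
    unfolding kernel_norm_sq_def
    by (rule integral_cong_AE) (use extremal_function_AE in \<open>auto simp: power2_eq_square\<close>)
  finally show ?thesis .
qed

lemma kernel_norm_sq_pos: "kernel_norm_sq > 0"
proof -
  have "integral {0..1} (extremal_function h) = (LINT x|lebesgue_on {0..1}. extremal_function h x)"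
    by (intro lebesgue_integral_eq_integral[symmetric] W2_10_integrable extremal_function_W2_10) simp
  \<comment> \<open>With all coefficients zero the error functional is plain integration.\<close>
  also have "\<dots> = kernel_norm_sq"
    using error_functional_extremal_function[of "\<lambda>_. 0"] by (simp add: error_functional_alt)
  finally have eq: "integral {0..1} (extremal_function h) = kernel_norm_sq" .
  have "h / 2 \<in> {0..1}" using mult_right_mono[of 1 "real N" h] N N_h h_pos by auto
  then have "kernel_norm_sq \<noteq> 0"
    using integral_eq_0_iff[OF continuous_on_extremal_function] extremal_function_nonneg
      extremal_function_midpoint eq by force
  moreover have "kernel_norm_sq \<ge> 0" by (simp add: kernel_norm_sq_def)
  ultimately show ?thesis by simp
qed

lemma error_norm_optimal_coeff_le: "error_norm N optimal_coeff \<le> sqrt kernel_norm_sq"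
  unfolding error_norm_def
proof (rule SUP_least)
  fix \<phi> assume "\<phi> \<in> {\<phi> \<in> W2_10. W2_10_norm \<phi> = 1}"
  then have \<phi>: "\<phi> \<in> W2_10" "(LINT x|lebesgue_on {0..1}. (deriv \<phi> x + \<phi> x)\<^sup>2) = 1"
    by (auto simp: W2_10_norm_def)
  have "\<bar>error_functional N optimal_coeff \<phi>\<bar> \<le> sqrt kernel_norm_sq"
    unfolding error_functional_optimal_coeff[OF \<phi>(1)] kernel_norm_sq_def
    using \<phi> kernel_norm_sq_pos
    by (intro abs_integral_mult_le error_kernel_square_integrable W2_10_deriv_plus_self)
       (auto simp: kernel_norm_sq_def)
  then show "ereal \<bar>error_functional N optimal_coeff \<phi>\<bar> \<le> sqrt kernel_norm_sq" by simp
qed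

section \<open>Lower bound, first variation and uniqueness\<close>

lemma error_norm_combination:
  fixes p :: "real poly" and s :: real
  defines "q \<equiv> LINT x|lebesgue_on {0..1}. (error_kernel h x + s * poly (pderiv p + p) x)\<^sup>2"
  assumes le: "error_norm N D \<le> ereal r" and q: "q > 0"
  shows "\<bar>kernel_norm_sq + s * error_functional N D (poly p)\<bar> \<le> r * sqrt q"
proof -
  \<comment> \<open>\<open>sqrt q\<close> is the seminorm of the extremal function plus
    \<open>s\<close> times \<open>p\<close>; dividing by it gives an admissible function of seminorm
    1.\<close>
  define t where "t = 1 / sqrt q"
  have t: "t > 0" "t\<^sup>2 = 1 / q" using q by (auto simp: t_def power_divide)
  define F where "F x = t * extremal_function h x + (t * s) * poly p x" for x
  have "(LINT x|lebesgue_on {0..1}. (t * error_kernel h x + (t * s) * poly (pderiv p + p) x)\<^sup>2) =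
      (LINT x|lebesgue_on {0..1}. t\<^sup>2 * (error_kernel h x + s * poly (pderiv p + p) x)\<^sup>2)"
    by (intro Bochner_Integration.integral_cong) (auto simp: power2_eq_square algebra_simps)
  also have "\<dots> = t\<^sup>2 * q" by (simp add: q_def)
  also have "\<dots> = 1" using t q by simp
  finally have "W2_10_norm F = 1" "F \<in> W2_10"
    using extremal_function_combination(1,2)[of t "t * s" p] by (simp_all add: F_def[abs_def])
  then have "ereal \<bar>error_functional N D F\<bar> \<le> ereal r"
    using error_norm_ge le order_trans by blast
  moreover have "error_functional N D F = t * (kernel_norm_sq + s * error_functional N D (poly p))"
    unfolding F_def
    by (subst error_functional_linear)
       (auto simp: error_functional_extremal_function algebra_simps
         intro!: continuous_imp_integrable_real continuous_on_extremal_function continuous_intros)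
  ultimately have "t * \<bar>kernel_norm_sq + s * error_functional N D (poly p)\<bar> \<le> r"
    using t(1) by (simp add: abs_mult)
  then show ?thesis using q by (simp add: t_def field_simps)
qed

lemma error_norm_ge_kernel_norm: "ereal (sqrt kernel_norm_sq) \<le> error_norm N D"
proof (rule ccontr)
  assume "\<not> ?thesis"
  then obtain r where r: "error_norm N D \<le> ereal r" "r < sqrt kernel_norm_sq"
    by (metis ereal_dense2 less_ereal.simps(1) linorder_not_le order_less_imp_le)
  \<comment> \<open>The unperturbed case: the extremal function alone is the test function.\<close>
  have "kernel_norm_sq \<le> r * sqrt kernel_norm_sq"
    using error_norm_combination[where s = 0 and p = 0, OF r(1)] kernel_norm_sq_pos
    by (simp add: kernel_norm_sq_def)
  also have "\<dots> < sqrt kernel_norm_sq * sqrt kernel_norm_sq"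
    using r(2) kernel_norm_sq_pos by (intro mult_strict_right_mono) auto
  finally show False using kernel_norm_sq_pos by simp
qed

text \<open>
  The defect \<open>f\<close> in the bound for \<open>\<phi>\<^sub>0 + s p\<close>, with \<open>\<phi>\<^sub>0\<close> the extremal function, is nonnegative
  for small \<open>s\<close> and vanishes at \<open>s = 0\<close>, so its derivative there is zero.
\<close>
lemma error_functional_poly_unique:
  fixes p :: "real poly"
  assumes le: "error_norm N D \<le> ereal (sqrt kernel_norm_sq)"
  shows "error_functional N D (poly p) =
    (LINT x|lebesgue_on {0..1}. error_kernel h x * poly (pderiv p + p) x)"
proof -
  let ?M = "lebesgue_on {0..1::real}" and ?A = kernel_norm_sq
  define L where "L = error_functional N D (poly p)"
  define b where "b = (LINT x|?M. error_kernel h x * poly (pderiv p + p) x)"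
  define c where "c = (LINT x|?M. (poly (pderiv p + p) x)\<^sup>2)"
  define q where "q s = (LINT x|?M. (error_kernel h x + s * poly (pderiv p + p) x)\<^sup>2)" for s
  have p2: "integrable ?M (\<lambda>x. (poly (pderiv p + p) x)\<^sup>2)"
    by (intro continuous_imp_integrable_real continuous_intros)
  have kp: "integrable ?M (\<lambda>x. error_kernel h x * poly (pderiv p + p) x)"
    by (intro integrable_mult_square_integrable error_kernel_square_integrable p2
        error_kernel_measurable_lebesgue_on continuous_imp_measurable_on_sets_lebesgue continuous_intros) simp
  have q: "q s = ?A + 2 * s * b + s\<^sup>2 * c" for s
  proof -
    have "q s = (LINT x|?M. (error_kernel h x)\<^sup>2 + (2 * s) * (error_kernel h x * poly (pderiv p + p) x)
        + s\<^sup>2 * (poly (pderiv p + p) x)\<^sup>2)"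
      unfolding q_def
      by (intro Bochner_Integration.integral_cong) (auto simp: power2_eq_square algebra_simps)
    also have "\<dots> = (LINT x|?M. (error_kernel h x)\<^sup>2)
        + (LINT x|?M. (2 * s) * (error_kernel h x * poly (pderiv p + p) x))
        + (LINT x|?M. s\<^sup>2 * (poly (pderiv p + p) x)\<^sup>2)"
      using error_kernel_square_integrable kp p2
      by (subst Bochner_Integration.integral_add; (intro Bochner_Integration.integrable_add integrable_mult_right)?)+ auto
    also have "\<dots> = ?A + 2 * s * b + s\<^sup>2 * c"
      by (simp only: integral_mult_right_zero kernel_norm_sq_def b_def c_def)
    finally show ?thesis .
  qed
  define f where "f s = ?A * (?A + 2 * s * b + s\<^sup>2 * c) - (?A + s * L)\<^sup>2" for s
  \<comment> \<open>The test function can be normalised only where \<open>q s\<close> is positive.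
    This holds near 0 by continuity, since \<open>q 0\<close> is \<open>?A\<close>.\<close>
  have "((\<lambda>s. ?A + 2 * s * b + s\<^sup>2 * c) \<longlongrightarrow> ?A + 2 * 0 * b + 0\<^sup>2 * c) (nhds 0)"
    by (intro tendsto_intros filterlim_ident)
  then have "\<forall>\<^sub>F s in nhds 0. q s > 0"
    using order_tendstoD(1)[of _ ?A "nhds 0" 0] kernel_norm_sq_pos by (simp add: q)
  then obtain d where d: "d > 0" "\<And>s. \<bar>0 - s\<bar> < d \<Longrightarrow> q s > 0"
    by (auto simp: eventually_nhds_metric dist_real_def)
  have f_nonneg: "f s \<ge> 0" if "\<bar>0 - s\<bar> < d" for s
  proof -
    have "\<bar>?A + s * L\<bar> \<le> sqrt ?A * sqrt (q s)"
      using error_norm_combination[OF le, of s p] d(2)[OF that] by (simp add: q_def L_def)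
    then have "\<bar>?A + s * L\<bar>\<^sup>2 \<le> (sqrt ?A * sqrt (q s))\<^sup>2" by (rule power_mono) simp
    also have "\<dots> = ?A * q s"
      using kernel_norm_sq_pos d(2)[OF that] by (simp add: power_mult_distrib)
    finally show ?thesis by (simp add: f_def q)
  qed
  have f_0: "f 0 = 0" by (simp add: f_def power2_eq_square)
  \<comment> \<open>The derivative is a multiple of \<open>b - L\<close> with a nonzero factor, so
    its vanishing at the minimum is the claim.\<close>
  have der: "(f has_real_derivative (2 * ?A * b - 2 * ?A * L)) (at 0)"
    unfolding f_def by (auto intro!: derivative_eq_intros)
  have "2 * ?A * b - 2 * ?A * L = 0"
    by (rule DERIV_local_min[OF der d(1)]) (simp add: f_0 f_nonneg)
  then show ?thesis using kernel_norm_sq_pos by (simp add: b_def L_def)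
qed

lemma error_norm_optimal_coeff: "error_norm N optimal_coeff = sqrt kernel_norm_sq"
  by (intro antisym error_norm_optimal_coeff_le error_norm_ge_kernel_norm)

lemma error_norm_minimizer_unique:
  assumes "error_norm N D \<le> ereal (sqrt kernel_norm_sq)" "\<beta> \<le> N"
  shows "D \<beta> = optimal_coeff \<beta>"
proof -
  \<comment> \<open>An unnormalised Lagrange polynomial: it vanishes at every node except the one
    with index \<open>\<beta>\<close>, so only that coefficient survives in the quadrature
    sum.\<close>
  define p where "p = (\<Prod>j\<in>{0..N} - {\<beta>}. [:- (real j * h), 1:])"
  have p: "poly p x = (\<Prod>j\<in>{0..N} - {\<beta>}. x - real j * h)" for x
    by (simp add: p_def poly_prod)
  have zero: "poly p (real j * h) = 0" if "j \<in> {0..N} - {\<beta>}" for j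
    unfolding p using that by (intro prod_zero bexI[of _ j]) auto
  have nonzero: "poly p (real \<beta> * h) \<noteq> 0"
    unfolding p using h_pos by auto
  have "(\<Sum>j=0..N. C j * poly p (real j * h)) = C \<beta> * poly p (real \<beta> * h)" for C
    using zero assms(2) by (subst sum.remove[of _ \<beta>]) auto
  \<comment> \<open>The first variation prescribes the same value for every coefficient family
    attaining the bound, \<open>optimal_coeff\<close> among them.\<close>
  moreover have "error_functional N D (poly p) = error_functional N optimal_coeff (poly p)"
    using error_functional_poly_unique[OF assms(1)]
      error_functional_poly_unique[of optimal_coeff] error_norm_optimal_coeff by simp
  ultimately show ?thesis using nonzero by (simp add: error_functional_alt)
qed

lemma optimal_coefficients_iff: "optimal_coefficients N C \<longleftrightarrow> (\<forall>\<beta>\<le>N. C \<beta> = optimal_coeff \<beta>)"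
proof -
  have "(INF D. error_norm N D) = sqrt kernel_norm_sq"
    by (rule antisym)
       (auto intro!: INF_lower2[of optimal_coeff] INF_greatest simp: error_norm_optimal_coeff error_norm_ge_kernel_norm)
  moreover have "error_norm N C = sqrt kernel_norm_sq" if "\<forall>\<beta>\<le>N. C \<beta> = optimal_coeff \<beta>"
    using error_norm_cong[of N C optimal_coeff] that by (simp add: error_norm_optimal_coeff)
  ultimately show ?thesis
    unfolding optimal_coefficients_def using error_norm_minimizer_unique by auto
qed

end

theorem theorem4:
  fixes N :: nat and h :: real and C :: "nat \<Rightarrow> real"
  assumes "N \<ge> 1" and "h = 1 / real N"
  shows "optimal_coefficients N C \<longleftrightarrow>
    (\<forall>\<beta>\<le>N. C \<beta> = (if \<beta> = 0 \<or> \<beta> = N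
                    then (exp h - 1) / (exp h + 1)
                    else 2 * (exp h - 1) / (exp h + 1)))"
proof -
  interpret uniform_mesh N h using assms by unfold_locales
  show ?thesis
    by (simp add: optimal_coefficients_iff optimal_coeff_def tanh_half_eq)
qed

end
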